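(* Let $a,b\ge 1$ be integers and consider the altered Wythoff game with $\mathcal{N}=\emptyset$ and $\mathcal{P}=\{0,1,\dots,a-1\}\times\{0,1,\dots,b-1\}$. Let $A$ be its set of P-positions and $B$ the set of P-positions of the unaltered Wythoff game. Then $A_{(b-1,a-1)}$ is asymptotically equal to $B$.
   Context: Wythoff's game: a position is a pair $(x,y)$ of non-negative integers. A move from $(x,y)$ goes to $(x-k,y)$, $(x,y-k)$ or $(x-k,y-k)$ for some integer $k\ge1$, provided the resulting coordinates are non-negative. An altered Wythoff game is given by finite disjoint sets $\mathcal{P},\mathcal{N}\subset\mathbb{Z}_{\ge0}^2$; positions are labelled by recursion on $x+y$: positions in $\mathcal{P}$ are P, positions in $\mathcal{N}$ are N, and any other position is P if no position reachable from it in one move is labelled P, and N otherwise. The set of P-positions is the set of positions labelled P. The unaltered game is $\mathcal{P}=\mathcal{N}=\emptyset$; its P-positions are $B=\{(\lfloor\phi n\rfloor,\lfloor\phi^2 n\rfloor):n\ge0\}\cup\{(\lfloor\phi^2 n\rfloor,\lfloor\phi n\rfloor):n\ge0\}$, $\phi=(1+\sqrt5)/2$. For $S\subseteq\mathbb{Z}^2$, $S_{(\Delta x,\Delta y)}=\{(x+\Delta x,y+\Delta y):(x,y)\in S\}$. With $B_n=\{(x,y)\in\mathbb{Z}^2:x^2+y^2\le n^2\}$, infinite sets $S,T\subseteq\mathbb{Z}^2$ are asymptotically equal if $\lim_{n\to\infty}|(S\cap T)\cap B_n|/|(S\cup T)\cap B_n|=1$. *)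

theory Defs
  imports Complex_Main
begin

definition wythoff_moves :: "nat \<times> nat \<Rightarrow> (nat \<times> nat) set" where
  "wythoff_moves p = (case p of (x, y) \<Rightarrow>
     {(x - k, y) | k. 1 \<le> k \<and> k \<le> x} \<union>
     {(x, y - k) | k. 1 \<le> k \<and> k \<le> y} \<union>
     {(x - k, y - k) | k. 1 \<le> k \<and> k \<le> x \<and> k \<le> y})"

lemma wythoff_moves_less:
  "q \<in> wythoff_moves p \<Longrightarrow> fst q + snd q < fst p + snd p"
  by (auto simp: wythoff_moves_def split: prod.splits)

(* labelled_P Ps Ns p: position p is labelled P in the game altered by Ps and Ns
   (labelled N otherwise).  Intended for finite disjoint Ps and Ns; the order of the
   two tests only matters when they overlap. *)
function labelled_P :: "(nat \<times> nat) set \<Rightarrow> (nat \<times> nat) set \<Rightarrow> nat \<times> nat \<Rightarrow> bool" where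
  "labelled_P Ps Ns p =
     (if p \<in> Ps then True
      else if p \<in> Ns then False
      else (\<forall>q \<in> wythoff_moves p. \<not> labelled_P Ps Ns q))"
  by auto
termination
  by (relation "measure (\<lambda>(Ps, Ns, p). fst p + snd p)") (auto dest: wythoff_moves_less)

declare labelled_P.simps [simp del]

definition P_positions :: "(nat \<times> nat) set \<Rightarrow> (nat \<times> nat) set \<Rightarrow> (int \<times> int) set" where
  "P_positions Ps Ns = {(int x, int y) | x y. labelled_P Ps Ns (x, y)}"

definition translate :: "int \<times> int \<Rightarrow> (int \<times> int) set \<Rightarrow> (int \<times> int) set" where
  "translate d S = {(x + fst d, y + snd d) | x y. (x, y) \<in> S}"

definition lattice_disc :: "nat \<Rightarrow> (int \<times> int) set" where
  "lattice_disc n = {(x, y). x\<^sup>2 + y\<^sup>2 \<le> (int n)\<^sup>2}"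

(* The notion is only meant for infinite sets, so infinitude is part of it. *)
definition asymptotically_equal :: "(int \<times> int) set \<Rightarrow> (int \<times> int) set \<Rightarrow> bool" where
  "asymptotically_equal S T \<longleftrightarrow> infinite S \<and> infinite T \<and>
     (\<lambda>n. real (card ((S \<inter> T) \<inter> lattice_disc n)) / real (card ((S \<union> T) \<inter> lattice_disc n)))
       \<longlonglongrightarrow> 1"

end

theory Submission
  imports Defs
begin

text \<open>
Write $a = \<alpha> + 1$, $b = \<beta> + 1$ and use coordinates shifted by $(\<beta>, \<alpha>)$. In them, the
rectangle excludes every row and column up to $\<alpha> + \<beta>$ and the diagonals
$y - x = -\<beta>, \<dots>, \<alpha>$ for all other P-positions. Beyond it, the P-positions above the main diagonal use the diagonals
$y - x = \<alpha> + 1, \<alpha> + 2, \<dots>$ in the order of their columns, and similarly below the main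
diagonal. Let $p(t)$ be the last diagonal used above up to column $t$ and $q(t)$ the last one used
below up to row $t$. The shift is chosen such that, for $t \<ge> \<alpha> + \<beta>$, columns are accounted for
by $p(t) + \<lambda>(t) = t$ with $d \<le> \<lambda>(t)$ iff $d \<le> q(t - d)$, a relation that no longer mentions
$\<alpha>$ and $\<beta>$; it holds for the unaltered $w$ in place of $p$ and $q$ as well.
So $|p(t) - w(t)|$ counts the $d$ for which exactly one of $d \<le> q(t - d)$ and $d \<le> w(t - d)$
holds, and since $(t, d) \<mapsto> (t - d, d)$ is injective,
$\<Sum>_{t \<le> n} |p(t) - w(t)| \<le> \<Sum>_{s \<le> 3n/4} |q(s) - w(s)| + O(1)$, and symmetrically.
Hence both sums are $O(\<surd>n)$ (even $O(log n)$), whereas the number of P-positions in the disc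
grows linearly.
\<close>

section \<open>The counting functions\<close>

text \<open>
With the notation above, $p$ is \<open>wy \<alpha> \<beta>\<close> and $q$ is \<open>wy \<beta> \<alpha>\<close>; column $t + 1$ is occupied
from below iff $\<lambda>(t) + 1 \<le> q(t - \<lambda>(t))$, where $t - \<lambda>(t) = p(t)$. The minimum only ensures
termination, as $p(t) \<le> t$ whenever $t \<ge> \<alpha> + \<beta>$.
\<close>

fun wy :: "nat \<Rightarrow> nat \<Rightarrow> nat \<Rightarrow> nat" where
  "wy \<alpha> \<beta> 0 = \<alpha>"
| "wy \<alpha> \<beta> (Suc t) =
     (if t < \<alpha> + \<beta> then \<alpha>
      else let k = wy \<alpha> \<beta> t in if t - k < wy \<beta> \<alpha> (min k t) then k else Suc k)"

declare wy.simps(2) [simp del]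

lemma wy_initial: "t \<le> \<alpha> + \<beta> \<Longrightarrow> wy \<alpha> \<beta> t = \<alpha>"
  by (cases t) (auto simp: wy.simps)

lemma wy_step: "wy \<alpha> \<beta> (Suc t) = wy \<alpha> \<beta> t \<or> wy \<alpha> \<beta> (Suc t) = Suc (wy \<alpha> \<beta> t)"
  by (cases "t < \<alpha> + \<beta>") (auto simp: wy.simps wy_initial Let_def)

lemma wy_mono: "s \<le> t \<Longrightarrow> wy \<alpha> \<beta> s \<le> wy \<alpha> \<beta> t"
proof (rule lift_Suc_mono_le[of "wy \<alpha> \<beta>"])
  show "wy \<alpha> \<beta> n \<le> wy \<alpha> \<beta> (Suc n)" for n
    using wy_step[of \<alpha> \<beta> n] by auto
qed

lemma wy_ge: "\<alpha> \<le> wy \<alpha> \<beta> t"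
  using wy_mono[of 0 t \<alpha> \<beta>] by simp

lemma wy_le: "\<alpha> + \<beta> \<le> t \<Longrightarrow> wy \<alpha> \<beta> t \<le> t"
proof (induction t rule: dec_induct)
  case base
  show ?case by (simp add: wy_initial)
next
  case (step n)
  then show ?case using wy_step[of \<alpha> \<beta> n] by auto
qed

lemma wy_le_add: "wy \<alpha> \<beta> t \<le> t + \<alpha>"
  by (cases "t \<le> \<alpha> + \<beta>") (use wy_le[of \<alpha> \<beta> t] in \<open>auto simp: wy_initial\<close>)

lemma wy_Suc: "\<alpha> + \<beta> \<le> t \<Longrightarrow>
  wy \<alpha> \<beta> (Suc t) = (if t - wy \<alpha> \<beta> t < wy \<beta> \<alpha> (wy \<alpha> \<beta> t) then wy \<alpha> \<beta> t else Suc (wy \<alpha> \<beta> t))"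
  using wy_le[of \<alpha> \<beta> t] by (auto simp: wy.simps Let_def min_def)

text \<open>As q is monotone, the d with d \<le> q(t - d) form an initial segment. The condition on
  d at t + 1 follows from that on d at t and implies that on d - 1 at t, so the segment grows by at
  most one. It grows iff l + 1 \<le> q(k) with k = t - l, which is the test in the recursion of
  \<open>wy\<close>.\<close>

lemma wy_threshold:
  assumes "\<alpha> + \<beta> \<le> t"
  shows "d \<le> t - wy \<alpha> \<beta> t \<longleftrightarrow> d \<le> t \<and> d \<le> wy \<beta> \<alpha> (t - d)"
  using assms
proof (induction t arbitrary: d rule: dec_induct)
  case base
  show ?case by (auto simp: wy_initial)
next
  case (step t)
  define k l where "k = wy \<alpha> \<beta> t" and "l = t - k"
  have k: "k \<le> t" using wy_le step.hyps by (simp add: k_def)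
  have IH: "e \<le> l \<longleftrightarrow> e \<le> t \<and> e \<le> wy \<beta> \<alpha> (t - e)" for e
    using step.IH by (simp add: l_def k_def)
  show ?case
  proof (cases "l < wy \<beta> \<alpha> k")
    case True
    then have S: "Suc t - wy \<alpha> \<beta> (Suc t) = Suc l"
      using wy_Suc[of \<alpha> \<beta> t] step.hyps k by (auto simp: k_def l_def)
    have "d \<le> Suc t \<and> d \<le> wy \<beta> \<alpha> (Suc t - d)" if "d \<le> Suc l"
    proof -
      have "k \<le> Suc t - d" using that k unfolding l_def by auto
      then show ?thesis using wy_mono[of k "Suc t - d" \<beta> \<alpha>] True that
        by (auto simp: l_def)
    qed
    moreover have "d \<le> Suc l" if "d \<le> Suc t" "d \<le> wy \<beta> \<alpha> (Suc t - d)"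
      \<comment> \<open>For d > 0, t - (d - 1) = Suc t - d.\<close>
      using IH[of "d - 1"] that by (cases d) auto
    ultimately show ?thesis unfolding S by blast
  next
    case False
    then have S: "Suc t - wy \<alpha> \<beta> (Suc t) = l"
      using wy_Suc[of \<alpha> \<beta> t] step.hyps k by (auto simp: k_def l_def)
    have "t - d \<le> Suc t - d" by simp
    from wy_mono[OF this, of \<beta> \<alpha>]
    have "d \<le> Suc t \<and> d \<le> wy \<beta> \<alpha> (Suc t - d)" if "d \<le> l"
      using IH[of d] that by linarith
    moreover have "d \<le> l" if "d \<le> Suc t" "d \<le> wy \<beta> \<alpha> (Suc t - d)"
    proof (rule ccontr)
      assume "\<not> d \<le> l"
      then have "Suc t - d \<le> k" unfolding l_def by auto
      then show False using wy_mono[of "Suc t - d" k \<beta> \<alpha>] False that \<open>\<not> d \<le> l\<close> by auto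
    qed
    ultimately show ?thesis unfolding S by blast
  qed
qed

text \<open>The threshold at d = t - p(t) reads t - p(t) \<le> q(p(t)), and q(s) \<le> s + \<beta>.
  This linear growth serves both the recursion for the deviation and the density of the
  P-positions.\<close>

lemma wy_lower_bound: "t \<le> 2 * wy \<alpha> \<beta> t + \<beta>"
proof (cases "\<alpha> + \<beta> \<le> t")
  case True
  then show ?thesis
    using wy_threshold[of \<alpha> \<beta> t "t - wy \<alpha> \<beta> t"] wy_le_add[of \<beta> \<alpha> "wy \<alpha> \<beta> t"] wy_le[of \<alpha> \<beta> t]
    by auto
qed (use wy_ge[of \<alpha> \<beta> t] in auto)

text \<open>A discrete intermediate value argument: p climbs from \<alpha> in steps of at most one
  and is constant up to \<alpha> + \<beta>.\<close>

lemma wy_hits: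
  assumes "\<alpha> < d" "d \<le> wy \<alpha> \<beta> t"
  obtains s where "\<alpha> + \<beta> \<le> s" "s < t" "wy \<alpha> \<beta> (Suc s) = d" "wy \<alpha> \<beta> s = d - 1"
proof -
  have "\<exists>s<t. wy \<alpha> \<beta> (Suc s) = d \<and> wy \<alpha> \<beta> s = d - 1"
    using assms(2)
  proof (induction t)
    case 0
    then show ?case using assms by simp
  next
    case (Suc t)
    then show ?case
      using wy_step[of \<alpha> \<beta> t] assms
      by (metis Suc_leI diff_Suc_1 le_antisym less_Suc_eq not_le)
  qed
  then obtain s where s: "s < t" "wy \<alpha> \<beta> (Suc s) = d" "wy \<alpha> \<beta> s = d - 1" by blast
  have "\<alpha> + \<beta> \<le> s"
  proof (rule ccontr)
    assume "\<not> \<alpha> + \<beta> \<le> s"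
    then show False using wy_initial[of "Suc s" \<alpha> \<beta>] s assms by auto
  qed
  with s show ?thesis using that by blast
qed

section \<open>The P-positions\<close>

text \<open>In shifted coordinates, these turn out to be the P-positions outside the rectangle above
  the main diagonal; those below are \<open>upper \<beta> \<alpha> y x\<close>, by
  reflection.\<close>

definition upper :: "nat \<Rightarrow> nat \<Rightarrow> nat \<Rightarrow> nat \<Rightarrow> bool" where
  "upper \<alpha> \<beta> x y \<longleftrightarrow>
     \<alpha> + \<beta> < x \<and> wy \<alpha> \<beta> x = Suc (wy \<alpha> \<beta> (x - 1)) \<and> y = x + wy \<alpha> \<beta> x"

definition kernel :: "nat \<Rightarrow> nat \<Rightarrow> nat \<Rightarrow> nat \<Rightarrow> bool" where
  "kernel \<alpha> \<beta> x y \<longleftrightarrow> upper \<alpha> \<beta> x y \<or> upper \<beta> \<alpha> y x"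

lemma kernel_swap: "kernel \<alpha> \<beta> x y \<longleftrightarrow> kernel \<beta> \<alpha> y x"
  by (auto simp: kernel_def)

lemma upper_gt: "upper \<alpha> \<beta> x y \<Longrightarrow> \<alpha> + \<beta> < x \<and> x + \<alpha> < y"
  using wy_ge[of \<alpha> \<beta> "x - 1"] by (auto simp: upper_def)

lemma upper_mono:
  assumes "upper \<alpha> \<beta> x y" "upper \<alpha> \<beta> x' y'" "x < x'"
  shows "y - x < y' - x'"
proof -
  have "wy \<alpha> \<beta> x \<le> wy \<alpha> \<beta> (x' - 1)" using assms(3) by (intro wy_mono) simp
  then show ?thesis using assms by (auto simp: upper_def)
qed

lemma upper_hits:
  assumes "\<alpha> < d" "d \<le> wy \<alpha> \<beta> t"
  obtains s where "s \<le> t" "upper \<alpha> \<beta> s (s + d)"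
proof -
  obtain s where s: "\<alpha> + \<beta> \<le> s" "s < t" "wy \<alpha> \<beta> (Suc s) = d" "wy \<alpha> \<beta> s = d - 1"
    using wy_hits assms .
  show ?thesis by (rule that[of "Suc s"]) (use s assms in \<open>auto simp: upper_def\<close>)
qed

text \<open>A jump of q at y to d makes d pass the threshold at x = y + d but not at x - 1, so
  \<lambda> grows at x and p does not. Conversely, growth of \<lambda> to l + 1 at x forces q to
  jump to l + 1 at y = x - (l + 1).\<close>

lemma column_iff:
  assumes "\<alpha> + \<beta> < x"
  shows "(\<exists>y. upper \<beta> \<alpha> y x) \<longleftrightarrow> wy \<alpha> \<beta> x = wy \<alpha> \<beta> (x - 1)"
proof -
  obtain t where t: "x = Suc t" "\<alpha> + \<beta> \<le> t" using assms by (cases x) auto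
  define l where "l = t - wy \<alpha> \<beta> t"
  have le: "wy \<alpha> \<beta> t \<le> t" using t wy_le by auto
  have th: "d \<le> l \<longleftrightarrow> d \<le> t \<and> d \<le> wy \<beta> \<alpha> (t - d)" for d
    using wy_threshold t by (simp add: l_def)
  have th': "d \<le> x - wy \<alpha> \<beta> x \<longleftrightarrow> d \<le> x \<and> d \<le> wy \<beta> \<alpha> (x - d)" for d
    using wy_threshold t by simp
  show ?thesis
  proof
    assume "\<exists>y. upper \<beta> \<alpha> y x"
    then obtain y where y: "upper \<beta> \<alpha> y x" ..
    define d where "d = wy \<beta> \<alpha> y"
    have yd: "x = y + d" "0 < y" "wy \<beta> \<alpha> (y - 1) < d"
      using y by (auto simp: upper_def d_def)
    have "d \<le> x - wy \<alpha> \<beta> x" using th'[of d] yd by (auto simp: d_def)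
    moreover have "t - d = y - 1" using yd t by auto
    then have "\<not> d \<le> l" using th[of d] yd by auto
    ultimately show "wy \<alpha> \<beta> x = wy \<alpha> \<beta> (x - 1)"
      using wy_step[of \<alpha> \<beta> t] t le by (auto simp: l_def)
  next
    assume eq: "wy \<alpha> \<beta> x = wy \<alpha> \<beta> (x - 1)"
    then have xl: "x - wy \<alpha> \<beta> x = Suc l" using t le by (auto simp: l_def)
    define y where "y = x - Suc l"
    have 1: "Suc l \<le> x" "Suc l \<le> wy \<beta> \<alpha> y" using th'[of "Suc l"] xl by (auto simp: y_def)
    have 2: "\<not> (Suc l \<le> t \<and> Suc l \<le> wy \<beta> \<alpha> (t - Suc l))" using th[of "Suc l"] by auto
    \<comment> \<open>Hence q(y) > \<beta>, so y lies beyond the initial range on which q is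
      constant.\<close>
    have "\<beta> \<le> l" using th[of \<beta>] t wy_ge[of \<beta> \<alpha> "t - \<beta>"] by auto
    have "\<beta> + \<alpha> < y"
    proof (rule ccontr)
      assume "\<not> \<beta> + \<alpha> < y"
      then have "wy \<beta> \<alpha> y = \<beta>" by (simp add: wy_initial)
      then show False using 1 \<open>\<beta> \<le> l\<close> by simp
    qed
    moreover have "t - Suc l = y - 1" "Suc l \<le> t" using calculation t by (auto simp: y_def)
    then have "wy \<beta> \<alpha> (y - 1) \<le> l" using 2 by auto
    moreover have "wy \<beta> \<alpha> y = wy \<beta> \<alpha> (y - 1) \<or> wy \<beta> \<alpha> y = Suc (wy \<beta> \<alpha> (y - 1))"
      using wy_step[of \<beta> \<alpha> "y - 1"] \<open>\<beta> + \<alpha> < y\<close> by auto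
    ultimately have "upper \<beta> \<alpha> y x"
      using 1 by (auto simp: upper_def y_def)
    then show "\<exists>y. upper \<beta> \<alpha> y x" ..
  qed
qed

section \<open>Independence and absorption of the kernel\<close>

lemma upper_not_both: "upper \<alpha> \<beta> x y \<Longrightarrow> \<not> upper \<beta> \<alpha> y' x"
  using column_iff[of \<alpha> \<beta> x] by (auto simp: upper_def)

lemma kernel_column_unique:
  assumes "kernel \<alpha> \<beta> x y" "kernel \<alpha> \<beta> x y'"
  shows "y = y'"
proof -
  have "y = y'" if "upper \<beta> \<alpha> y x" "upper \<beta> \<alpha> y' x"
    using upper_mono[OF that] upper_mono[OF that(2,1)] upper_gt[OF that(1)] upper_gt[OF that(2)]
    by (cases y y' rule: linorder_cases) auto
  then show ?thesis
    using assms upper_not_both by (auto simp: kernel_def) (auto simp: upper_def)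
qed

lemma kernel_diagonal_unique:
  assumes "kernel \<alpha> \<beta> x y" "kernel \<alpha> \<beta> (x + k) (y + k)"
  shows "k = 0"
proof -
  have *: "k = 0" if "upper \<alpha> \<beta> x y" "upper \<alpha> \<beta> (x + k) (y + k)" for \<alpha> \<beta> x y
    using upper_mono[OF that] upper_gt[OF that(1)] by (cases "k = 0") auto
  show ?thesis
    using assms *[of \<alpha> \<beta> x y] *[of \<beta> \<alpha> y x] upper_gt[of \<alpha> \<beta> x y] upper_gt[of \<beta> \<alpha> y x]
      upper_gt[of \<alpha> \<beta> "x + k" "y + k"] upper_gt[of \<beta> \<alpha> "y + k" "x + k"]
    unfolding kernel_def by auto
qed

text \<open>If the column is taken from below, or from above at a height less than y, a vertical
  move reaches that point. Otherwise the diagonal of (x, y) comes before the one reached at x, so an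
  earlier column uses it and a diagonal move gets there.\<close>

lemma kernel_absorbing_upper:
  assumes "\<alpha> + \<beta> < x" "x + \<alpha> < y" "\<not> kernel \<alpha> \<beta> x y"
  shows "\<exists>k\<ge>1. (k \<le> y \<and> kernel \<alpha> \<beta> x (y - k)) \<or>
                (k \<le> x \<and> k \<le> y \<and> kernel \<alpha> \<beta> (x - k) (y - k))"
proof (cases "wy \<alpha> \<beta> x = wy \<alpha> \<beta> (x - 1)")
  case True
  then obtain z where z: "upper \<beta> \<alpha> z x" using column_iff assms by blast
  then have "z < y" using upper_gt assms by fastforce
  then show ?thesis using z by (intro exI[of _ "y - z"]) (auto simp: kernel_def)
next
  case False
  define e where "e = wy \<alpha> \<beta> x"
  have u: "upper \<alpha> \<beta> x (x + e)"
    using False wy_step[of \<alpha> \<beta> "x - 1"] assms by (auto simp: upper_def e_def)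
  then have ne: "y \<noteq> x + e" using assms by (auto simp: kernel_def)
  show ?thesis
  proof (cases "x + e < y")
    case True
    then show ?thesis using u by (intro exI[of _ "y - (x + e)"]) (auto simp: kernel_def)
  next
    case False
    define d where "d = y - x"
    have d: "\<alpha> < d" "d \<le> e" "y = x + d" "d \<noteq> e" using False assms ne by (auto simp: d_def)
    obtain s where s: "s \<le> x" "upper \<alpha> \<beta> s (s + d)"
      using upper_hits[of \<alpha> d \<beta> x] d by (auto simp: e_def)
    have "s \<noteq> x" using s d by (auto simp: upper_def e_def)
    then show ?thesis using s d
      by (intro exI[of _ "x - s"]) (auto simp: kernel_def add.commute)
  qed
qed

lemma kernel_absorbing:
  assumes "\<alpha> + \<beta> < x" "\<alpha> + \<beta> < y" "x + \<alpha> < y \<or> y + \<beta> < x" "\<not> kernel \<alpha> \<beta> x y"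
  shows "\<exists>k\<ge>1. (k \<le> x \<and> kernel \<alpha> \<beta> (x - k) y) \<or> (k \<le> y \<and> kernel \<alpha> \<beta> x (y - k)) \<or>
                (k \<le> x \<and> k \<le> y \<and> kernel \<alpha> \<beta> (x - k) (y - k))"
proof (cases "x + \<alpha> < y")
  case True
  then show ?thesis using kernel_absorbing_upper[of \<alpha> \<beta> x y] assms by blast
next
  case False
  then have "\<exists>k\<ge>1. (k \<le> x \<and> kernel \<beta> \<alpha> y (x - k)) \<or>
                (k \<le> y \<and> k \<le> x \<and> kernel \<beta> \<alpha> (y - k) (x - k))"
    using assms kernel_swap[of \<alpha> \<beta> x y] by (intro kernel_absorbing_upper) auto
  then show ?thesis unfolding kernel_swap[of \<beta> \<alpha>] by blast
qed

section \<open>Identification of the labelling with the kernel\<close>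

lemma labelled_P_characterization:
  assumes "\<And>p. p \<in> Ps \<Longrightarrow> K p"
    and "\<And>p. p \<notin> Ps \<Longrightarrow> K p \<longleftrightarrow> (\<forall>q\<in>wythoff_moves p. \<not> K q)"
  shows "labelled_P Ps {} p \<longleftrightarrow> K p"
proof (induction "fst p + snd p" arbitrary: p rule: less_induct)
  case less
  have "(\<forall>q\<in>wythoff_moves p. \<not> labelled_P Ps {} q) \<longleftrightarrow> (\<forall>q\<in>wythoff_moves p. \<not> K q)"
    using less wythoff_moves_less by blast
  then show ?case
    using assms by (subst labelled_P.simps) auto
qed

text \<open>Both sides obey the recursion of the labelling. Uniqueness in rows, columns and
  diagonals forbids moves within the kernel; a position outside both sets reaches the rectangle if a
  coordinate is small or its diagonal is central, and the kernel otherwise.\<close>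

lemma labelled_P_rectangle:
  "labelled_P ({0..\<alpha>} \<times> {0..\<beta>}) {} (x, y) \<longleftrightarrow>
     x \<le> \<alpha> \<and> y \<le> \<beta> \<or> kernel \<alpha> \<beta> (x + \<beta>) (y + \<alpha>)"
proof -
  define R where "R = {0..\<alpha>} \<times> {0..\<beta>}"
  define K where "K = (\<lambda>(x, y). x \<le> \<alpha> \<and> y \<le> \<beta> \<or> kernel \<alpha> \<beta> (x + \<beta>) (y + \<alpha>))"
  have gt: "\<alpha> < x \<and> \<beta> < y \<and> (x + \<beta> + \<alpha> < y + \<alpha> \<or> y + \<alpha> + \<beta> < x + \<beta>)"
    if "kernel \<alpha> \<beta> (x + \<beta>) (y + \<alpha>)" for x y
    using that upper_gt[of \<alpha> \<beta> "x + \<beta>" "y + \<alpha>"] upper_gt[of \<beta> \<alpha> "y + \<alpha>" "x + \<beta>"]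
    by (auto simp: kernel_def)
  have "labelled_P R {} (x, y) \<longleftrightarrow> K (x, y)" for x y
  proof (rule labelled_P_characterization)
    show "K p" if "p \<in> R" for p using that by (auto simp: K_def R_def)
  next
    fix p assume "p \<notin> R"
    obtain x y where p: "p = (x, y)" by fastforce
    have nR: "\<not> (x \<le> \<alpha> \<and> y \<le> \<beta>)" using \<open>p \<notin> R\<close> by (auto simp: R_def p)
    show "K p \<longleftrightarrow> (\<forall>q\<in>wythoff_moves p. \<not> K q)"
    proof
      assume "K p"
      then have ker: "kernel \<alpha> \<beta> (x + \<beta>) (y + \<alpha>)" using nR by (simp add: K_def p)
      note g = gt[OF ker]
      have h: "\<not> K (x - k, y)" if "1 \<le> k" "k \<le> x" for k
        using kernel_column_unique[of \<beta> \<alpha> "y + \<alpha>" "x + \<beta>" "x - k + \<beta>"] ker that g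
        by (auto simp: K_def kernel_swap[of \<beta> \<alpha>])
      have v: "\<not> K (x, y - k)" if "1 \<le> k" "k \<le> y" for k
        using kernel_column_unique[of \<alpha> \<beta> "x + \<beta>" "y + \<alpha>" "y - k + \<alpha>"] ker that g
        by (auto simp: K_def)
      have d: "\<not> K (x - k, y - k)" if "1 \<le> k" "k \<le> x" "k \<le> y" for k
        using kernel_diagonal_unique[of \<alpha> \<beta> "x - k + \<beta>" "y - k + \<alpha>" k] ker that g
        by (auto simp: K_def)
      show "\<forall>q\<in>wythoff_moves p. \<not> K q"
        using h v d by (auto simp: wythoff_moves_def p)
    next
      assume no: "\<forall>q\<in>wythoff_moves p. \<not> K q"
      have h: "\<not> K (x - k, y)" if "1 \<le> k" "k \<le> x" for k
        using no that unfolding wythoff_moves_def p by blast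
      have v: "\<not> K (x, y - k)" if "1 \<le> k" "k \<le> y" for k
        using no that unfolding wythoff_moves_def p by blast
      have d: "\<not> K (x - k, y - k)" if "1 \<le> k" "k \<le> x" "k \<le> y" for k
        using no that unfolding wythoff_moves_def p by blast
      \<comment> \<open>Otherwise x > \<alpha>, and the horizontal move by x - \<alpha> ends at
        (\<alpha>, y) in the rectangle.\<close>
      have "\<beta> < y" using h[of "x - \<alpha>"] nR by (cases "x \<le> \<alpha>") (auto simp: K_def Suc_le_eq)
      have "\<alpha> < x" using v[of "y - \<beta>"] nR by (cases "y \<le> \<beta>") (auto simp: K_def Suc_le_eq)
      have "x + \<beta> < y \<or> y + \<alpha> < x"
      proof (rule ccontr)
        assume "\<not> (x + \<beta> < y \<or> y + \<alpha> < x)"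
        \<comment> \<open>The diagonal move by the larger of x - \<alpha> and y - \<beta> ends in
          the rectangle.\<close>
        then have "x - \<alpha> \<le> y" "y - \<beta> \<le> x" by auto
        then show False
          using d[of "x - \<alpha>"] d[of "y - \<beta>"] \<open>\<alpha> < x\<close> \<open>\<beta> < y\<close>
          by (cases "y - \<beta> \<le> x - \<alpha>") (auto simp: K_def Suc_le_eq)
      qed
      then have away: "x + \<beta> + \<alpha> < y + \<alpha> \<or> y + \<alpha> + \<beta> < x + \<beta>" by auto
      have "kernel \<alpha> \<beta> (x + \<beta>) (y + \<alpha>)"
      proof (rule ccontr)
        assume "\<not> ?thesis"
        from kernel_absorbing[OF _ _ away this] \<open>\<alpha> < x\<close> \<open>\<beta> < y\<close>
        obtain k where k: "1 \<le> k"
          "(k \<le> x + \<beta> \<and> kernel \<alpha> \<beta> (x + \<beta> - k) (y + \<alpha>)) \<or>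
           (k \<le> y + \<alpha> \<and> kernel \<alpha> \<beta> (x + \<beta>) (y + \<alpha> - k)) \<or>
           (k \<le> x + \<beta> \<and> k \<le> y + \<alpha> \<and> kernel \<alpha> \<beta> (x + \<beta> - k) (y + \<alpha> - k))" by auto
        \<comment> \<open>Both coordinates of a kernel point exceed \<alpha> + \<beta>, so a move to
          it in shifted coordinates is legal before the shift too.\<close>
        have b: "\<alpha> + \<beta> < X \<and> \<alpha> + \<beta> < Y" if "kernel \<alpha> \<beta> X Y" for X Y
          using that upper_gt[of \<alpha> \<beta> X Y] upper_gt[of \<beta> \<alpha> Y X] by (auto simp: kernel_def)
        from k(2) consider "kernel \<alpha> \<beta> (x + \<beta> - k) (y + \<alpha>)" | "kernel \<alpha> \<beta> (x + \<beta>) (y + \<alpha> - k)"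
          | "kernel \<alpha> \<beta> (x + \<beta> - k) (y + \<alpha> - k)" by blast
        then show False
        proof cases
          case 1
          moreover have "k \<le> x" using b[OF 1] by linarith+
          ultimately show False using h[of k] k(1) by (auto simp: K_def)
        next
          case 2
          moreover have "k \<le> y" using b[OF 2] by linarith+
          ultimately show False using v[of k] k(1) by (auto simp: K_def)
        next
          case 3
          moreover have "k \<le> x" "k \<le> y" using b[OF 3] by linarith+
          ultimately show False using d[of k] k(1) by (auto simp: K_def)
        qed
      qed
      then show "K p" by (simp add: K_def p)
    qed
  qed
  then show ?thesis by (simp add: R_def K_def)
qed

text \<open>The origin has no moves and is P anyway, so the unaltered game is the case a = b =
  1.\<close>

lemma labelled_P_unaltered: "labelled_P {} {} p \<longleftrightarrow> labelled_P ({0..0} \<times> {0..0}) {} p"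
proof (rule labelled_P_characterization)
  fix p :: "nat \<times> nat"
  show "labelled_P ({0..0} \<times> {0..0}) {} p \<longleftrightarrow>
    (\<forall>q\<in>wythoff_moves p. \<not> labelled_P ({0..0} \<times> {0..0}) {} q)"
    by (subst labelled_P.simps) (auto simp: wythoff_moves_def)
qed auto

section \<open>Comparison with the unaltered game\<close>

definition gap :: "nat \<Rightarrow> nat \<Rightarrow> nat" where
  "gap x y = (x - y) + (y - x)"

lemma gap_eq_card: "gap x y = card {d. (d \<le> x) \<noteq> (d \<le> y)}"
proof -
  have "{d. (d \<le> x) \<noteq> (d \<le> y)} = {y<..x} \<union> {x<..y}" by auto
  then show ?thesis by (cases "x \<le> y") (auto simp: gap_def)
qed

lemma finite_gap: "finite {d. (d \<le> x) \<noteq> (d \<le> (y :: nat))}"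
  by (rule finite_subset[of _ "{..x + y}"]) auto

definition deviation :: "nat \<Rightarrow> nat \<Rightarrow> nat \<Rightarrow> nat" where
  "deviation \<alpha> \<beta> n = (\<Sum>t\<le>n. gap (wy \<alpha> \<beta> t) (wy 0 0 t))"

lemma deviation_recursion:
  assumes "8 + 4 * (\<alpha> + \<beta>) \<le> n"
  shows "deviation \<alpha> \<beta> n \<le> deviation \<beta> \<alpha> (3 * n div 4) + deviation \<alpha> \<beta> (\<alpha> + \<beta>)"
proof -
  define M where "M = 3 * n div 4"
  define D where "D t = {d. (d \<le> t - wy \<alpha> \<beta> t) \<noteq> (d \<le> t - wy 0 0 t)}" for t
  define E where "E t = {d. (d \<le> wy \<beta> \<alpha> t) \<noteq> (d \<le> wy 0 0 t)}" for t
  have fin: "finite (D t)" "finite (E t)" for t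
    unfolding D_def E_def by (rule finite_gap)+
  have DI: "(d \<le> t \<and> d \<le> wy \<beta> \<alpha> (t - d)) \<noteq> (d \<le> t \<and> d \<le> wy 0 0 (t - d))"
    if "d \<in> D t" "\<alpha> + \<beta> < t" for d t
    using that wy_threshold[of \<alpha> \<beta> t d] wy_threshold[of 0 0 t d] by (auto simp: D_def)
  \<comment> \<open>For small \<open>d\<close>, both \<open>d \<le> q(t - d)\<close> and \<open>d \<le> w(t - d)\<close> hold, so \<open>d\<close> is not counted.\<close>
  have early: "t - d \<le> M" if d: "d \<in> D t" and t: "\<alpha> + \<beta> < t" "t \<le> n" for t d
  proof (rule ccontr)
    assume "\<not> t - d \<le> M"
    then have "M + 1 \<le> t - d" "d + M < n" using t by auto
    then have "M + 1 \<le> 2 * wy \<beta> \<alpha> (t - d) + \<alpha>" "M + 1 \<le> 2 * wy 0 0 (t - d)"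
      using wy_lower_bound[of "t - d" \<beta> \<alpha>] wy_lower_bound[of "t - d" 0 0] by auto
    moreover have "3 * n \<le> 4 * M + 3" unfolding M_def by linarith
    \<comment> \<open>With d < n - M, it suffices that 2(n - M) + \<alpha> is at most about M. Any
      ratio M/n above 2/3 leaves linear slack; 3/4 leaves about n/4, which absorbs \<alpha> because
      n \<ge> 4\<alpha>.\<close>
    then have "2 * d + \<alpha> \<le> M + 1" using assms \<open>d + M < n\<close> by (simp add: algebra_simps)
    ultimately show False using DI[OF d t(1)] by auto
  qed
  have "(\<Sum>t\<in>{\<alpha> + \<beta><..n}. gap (wy \<alpha> \<beta> t) (wy 0 0 t)) = (\<Sum>t\<in>{\<alpha> + \<beta><..n}. card (D t))"
  proof (rule sum.cong[OF refl])
    fix t assume "t \<in> {\<alpha> + \<beta><..n}"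
    \<comment> \<open>In both games p and \<lambda> add up to t; \<open>wy_le\<close> makes the
      truncated subtraction exact.\<close>
    then have "gap (wy \<alpha> \<beta> t) (wy 0 0 t) = gap (t - wy \<alpha> \<beta> t) (t - wy 0 0 t)"
      using wy_le[of \<alpha> \<beta> t] wy_le[of 0 0 t] by (auto simp: gap_def)
    then show "gap (wy \<alpha> \<beta> t) (wy 0 0 t) = card (D t)" by (simp add: gap_eq_card D_def)
  qed
  also have "\<dots> = card (SIGMA t:{\<alpha> + \<beta><..n}. D t)"
    by (simp add: fin)
  also have "\<dots> \<le> card (SIGMA t:{..M}. E t)"
  proof (rule card_inj_on_le[where f = "\<lambda>(t, d). (t - d, d)"])
    \<comment> \<open>\<open>DI\<close> yields d \<le> t, so t - d is not truncated and determines
      t.\<close>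
    show "inj_on (\<lambda>(t, d). (t - d, d)) (SIGMA t:{\<alpha> + \<beta><..n}. D t)"
      using DI by (auto simp: inj_on_def) (metis eq_diff_iff)+
    show "(\<lambda>(t, d). (t - d, d)) ` (SIGMA t:{\<alpha> + \<beta><..n}. D t) \<subseteq> (SIGMA t:{..M}. E t)"
      using DI early by (fastforce simp: E_def)
    show "finite (SIGMA t:{..M}. E t)" by (simp add: fin)
  qed
  also have "\<dots> = (\<Sum>t\<le>M. card (E t))"
    by (simp add: fin)
  also have "\<dots> = deviation \<beta> \<alpha> M"
    by (simp add: deviation_def gap_eq_card E_def)
  finally have "(\<Sum>t\<in>{\<alpha> + \<beta><..n}. gap (wy \<alpha> \<beta> t) (wy 0 0 t)) \<le> deviation \<beta> \<alpha> M" .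
  moreover have "{..n} = {..\<alpha> + \<beta>} \<union> {\<alpha> + \<beta><..n}" using assms by auto
  then have "deviation \<alpha> \<beta> n =
      deviation \<alpha> \<beta> (\<alpha> + \<beta>) + (\<Sum>t\<in>{\<alpha> + \<beta><..n}. gap (wy \<alpha> \<beta> t) (wy 0 0 t))"
    unfolding deviation_def by (simp only:) (intro sum.union_disjoint; auto)
  ultimately show ?thesis by (simp add: M_def)
qed

text \<open>Passing to 3n/4 shrinks the square root by a factor of at most 7/8, as 3/4 \<le> 49/64;
  the remaining C/8 pays for K.\<close>

lemma sqrt_growth:
  fixes f :: "nat \<Rightarrow> nat"
  assumes "2 \<le> N" and rec: "\<And>n. N \<le> n \<Longrightarrow> f n \<le> f (3 * n div 4) + K"
  shows "\<exists>C. \<forall>n\<ge>1. real (f n) \<le> C * sqrt n"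
proof -
  \<comment> \<open>The term 8K serves the induction step, the sum all n < N.\<close>
  define C where "C = real (8 * K + (\<Sum>n<N. f n))"
  have C: "8 * real K \<le> C" "0 \<le> C" by (auto simp: C_def simp flip: of_nat_sum)
  have "real (f n) \<le> C * sqrt n" if "n \<ge> 1" for n
    using that
  proof (induction n rule: less_induct)
    case (less n)
    have s: "1 \<le> sqrt n" using less.prems by simp
    show ?case
    proof (cases "n < N")
      case True
      then have "f n \<le> (\<Sum>n<N. f n)" by (intro member_le_sum) auto
      then have "real (f n) \<le> C * 1" by (simp add: C_def flip: of_nat_sum)
      also have "\<dots> \<le> C * sqrt n" using s C by (intro mult_left_mono) auto
      finally show ?thesis .
    next
      case False
      define m where "m = 3 * n div 4"
      have m: "1 \<le> m" "m < n" "real m \<le> 3 / 4 * real n"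
        using False assms(1) by (auto simp: m_def)
      have "sqrt m \<le> sqrt ((7 / 8)\<^sup>2 * real n)"
        using m(3) by (intro real_sqrt_le_mono) (auto simp: power2_eq_square)
      also have "\<dots> = 7 / 8 * sqrt n" by (simp add: real_sqrt_mult)
      finally have "C * sqrt m \<le> C * (7 / 8 * sqrt n)" using C by (intro mult_left_mono) auto
      moreover have "C * 1 \<le> C * sqrt n" using s C by (intro mult_left_mono) auto
      moreover have "real (f m) \<le> C * sqrt m" using less.IH m by blast
      moreover have "f n \<le> f m + K" using rec[of n] False by (simp add: m_def)
      then have "real (f n) \<le> real (f m) + real K" by linarith
      ultimately show ?thesis using C by simp
    qed
  qed
  then show ?thesis by blast
qed

section \<open>Columns in which the games may differ\<close>

definition exceptional :: "nat \<Rightarrow> nat \<Rightarrow> nat \<Rightarrow> nat set" where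
  "exceptional \<alpha> \<beta> n =
     {x. x \<le> n \<and> (x \<le> \<alpha> + \<beta> \<or> wy \<alpha> \<beta> x \<noteq> wy 0 0 x \<or> wy \<alpha> \<beta> (x - 1) \<noteq> wy 0 0 (x - 1))}"

lemma upper_unexceptional:
  "x \<le> n \<Longrightarrow> x \<notin> exceptional \<alpha> \<beta> n \<Longrightarrow> upper \<alpha> \<beta> x y \<longleftrightarrow> upper 0 0 x y"
  by (auto simp: exceptional_def upper_def)

text \<open>Each t with p(t) \<noteq> w(t) adds at least 1 to the deviation and spoils only the
  columns t and t + 1, hence the factor 2.\<close>

lemma card_exceptional: "card (exceptional \<alpha> \<beta> n) \<le> \<alpha> + \<beta> + 1 + 2 * deviation \<alpha> \<beta> n"
proof -
  define Z where "Z = {x. x \<le> n \<and> wy \<alpha> \<beta> x \<noteq> wy 0 0 x}"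
  have "card Z = (\<Sum>x\<in>Z. 1)" by simp
  also have "\<dots> \<le> (\<Sum>x\<in>Z. gap (wy \<alpha> \<beta> x) (wy 0 0 x))"
    by (intro sum_mono) (auto simp: Z_def gap_def)
  also have "\<dots> \<le> deviation \<alpha> \<beta> n"
    unfolding deviation_def by (intro sum_mono2) (auto simp: Z_def)
  finally have Z: "card Z \<le> deviation \<alpha> \<beta> n" .
  have fin: "finite Z" by (simp add: Z_def)
  have "exceptional \<alpha> \<beta> n \<subseteq> {..\<alpha> + \<beta>} \<union> (Z \<union> Suc ` Z)"
  proof
    fix x assume "x \<in> exceptional \<alpha> \<beta> n"
    then show "x \<in> {..\<alpha> + \<beta>} \<union> (Z \<union> Suc ` Z)"
      by (cases x) (auto simp: exceptional_def Z_def)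
  qed
  then have "card (exceptional \<alpha> \<beta> n) \<le> card ({..\<alpha> + \<beta>} \<union> (Z \<union> Suc ` Z))"
    by (rule card_mono[rotated]) (simp add: fin)
  also have "\<dots> \<le> card {..\<alpha> + \<beta>} + (card Z + card (Suc ` Z))"
    by (meson card_Un_le add_left_mono order_trans)
  also have "\<dots> \<le> \<alpha> + \<beta> + 1 + 2 * deviation \<alpha> \<beta> n"
    using Z card_image_le[OF fin, of Suc] by simp
  finally show ?thesis .
qed

section \<open>P-positions as lattice sets\<close>

definition shifted_P :: "nat \<Rightarrow> nat \<Rightarrow> (int \<times> int) set" where
  "shifted_P \<alpha> \<beta> = {(int x, int y) | x y.
     (\<beta> \<le> x \<and> x \<le> \<alpha> + \<beta> \<and> \<alpha> \<le> y \<and> y \<le> \<alpha> + \<beta>) \<or> kernel \<alpha> \<beta> x y}"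

lemma translate_P_positions:
  "translate (int \<beta>, int \<alpha>) (P_positions ({0..\<alpha>} \<times> {0..\<beta>}) {}) = shifted_P \<alpha> \<beta>"
proof -
  \<comment> \<open>Kernel points can be shifted back without truncation.\<close>
  have b: "\<beta> \<le> x \<and> \<alpha> \<le> y" if "kernel \<alpha> \<beta> x y" for x y
    using that upper_gt[of \<alpha> \<beta> x y] upper_gt[of \<beta> \<alpha> y x] by (auto simp: kernel_def)
  have "(u, v) \<in> shifted_P \<alpha> \<beta> \<longleftrightarrow>
        (\<exists>x y. u = int (x + \<beta>) \<and> v = int (y + \<alpha>) \<and> (x \<le> \<alpha> \<and> y \<le> \<beta> \<or> kernel \<alpha> \<beta> (x + \<beta>) (y + \<alpha>)))"
    (is "_ \<longleftrightarrow> ?R") for u v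
  proof
    assume "(u, v) \<in> shifted_P \<alpha> \<beta>"
    then obtain x y where "u = int x" "v = int y"
      "(\<beta> \<le> x \<and> x \<le> \<alpha> + \<beta> \<and> \<alpha> \<le> y \<and> y \<le> \<alpha> + \<beta>) \<or> kernel \<alpha> \<beta> x y"
      by (auto simp: shifted_P_def)
    then show ?R using b[of x y]
      by (intro exI[of _ "x - \<beta>"] exI[of _ "y - \<alpha>"]) auto
  next
    assume ?R
    then obtain x y where "u = int (x + \<beta>)" "v = int (y + \<alpha>)"
      "x \<le> \<alpha> \<and> y \<le> \<beta> \<or> kernel \<alpha> \<beta> (x + \<beta>) (y + \<alpha>)"
      by blast
    then show "(u, v) \<in> shifted_P \<alpha> \<beta>"
      unfolding shifted_P_def by (intro CollectI exI[of _ "x + \<beta>"] exI[of _ "y + \<alpha>"]) auto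
  qed
  then show ?thesis
    unfolding translate_def P_positions_def labelled_P_rectangle by auto
qed

lemma P_positions_unaltered: "P_positions {} {} = shifted_P 0 0"
proof -
  have "P_positions {} {} = P_positions ({0..0} \<times> {0..0}) {}"
    unfolding P_positions_def using labelled_P_unaltered by blast
  then show ?thesis
    using translate_P_positions[of 0 0] by (simp add: translate_def)
qed

lemma lattice_disc_bounds:
  assumes "(int x, int y) \<in> lattice_disc n"
  shows "x \<le> n" "y \<le> n"
proof -
  have "int (x\<^sup>2 + y\<^sup>2) \<le> int (n\<^sup>2)" using assms by (simp add: lattice_disc_def)
  then have "x\<^sup>2 + y\<^sup>2 \<le> n\<^sup>2" by (simp only: of_nat_le_iff)
  then have "x\<^sup>2 \<le> n\<^sup>2" "y\<^sup>2 \<le> n\<^sup>2" by linarith+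
  then show "x \<le> n" "y \<le> n" by (auto intro: power2_le_imp_le)
qed

lemma finite_lattice_disc: "finite (lattice_disc n)"
proof (rule finite_subset)
  show "lattice_disc n \<subseteq> {- int n..int n} \<times> {- int n..int n}"
  proof clarify
    fix x y assume "(x, y) \<in> lattice_disc n"
    then have "x\<^sup>2 + y\<^sup>2 \<le> (int n)\<^sup>2" by (simp add: lattice_disc_def)
    then have "x\<^sup>2 \<le> (int n)\<^sup>2" "y\<^sup>2 \<le> (int n)\<^sup>2"
      using zero_le_power2[of x] zero_le_power2[of y] by linarith+
    then have "\<bar>x\<bar> \<le> int n" "\<bar>y\<bar> \<le> int n" by (auto simp: abs_le_square_iff[symmetric])
    then show "x \<in> {- int n..int n} \<and> y \<in> {- int n..int n}" by auto
  qed
qed simp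

text \<open>A differing point lies in a square containing both rectangles, or is an upper point of
  one game in an exceptional column, or a lower point of one game in an exceptional row. The last
  two kinds lie on four graphs over exceptional sets.\<close>

lemma card_symmetric_difference:
  "card ((sym_diff (shifted_P \<alpha> \<beta>) (shifted_P 0 0)) \<inter> lattice_disc n)
     \<le> (\<alpha> + \<beta> + 1)\<^sup>2 + 4 * (\<alpha> + \<beta> + 1) + 4 * (deviation \<alpha> \<beta> n + deviation \<beta> \<alpha> n)"
proof -
  let ?e = "\<lambda>(x, y). (int x, int y)"
  let ?E = "exceptional \<alpha> \<beta> n" and ?F = "exceptional \<beta> \<alpha> n"
  define G where "G = ((\<lambda>x. (x, x + wy \<alpha> \<beta> x)) ` ?E \<union> (\<lambda>x. (x, x + wy 0 0 x)) ` ?E)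
    \<union> ((\<lambda>y. (y + wy \<beta> \<alpha> y, y)) ` ?F \<union> (\<lambda>y. (y + wy 0 0 y, y)) ` ?F)"
  define R where "R = {..\<alpha> + \<beta>} \<times> {..\<alpha> + \<beta>}"
  have fin: "finite ?E" "finite ?F" by (auto simp: exceptional_def)
  have cUn: "card (A \<union> B) \<le> k + l" if "card A \<le> k" "card B \<le> l" for A B :: "(nat \<times> nat) set" and k l
    using card_Un_le[of A B] that by linarith
  have "card G \<le> (card ?E + card ?E) + (card ?F + card ?F)"
    unfolding G_def by (intro cUn card_image_le fin)
  then have "card (R \<union> G) \<le> (\<alpha> + \<beta> + 1)\<^sup>2 + ((card ?E + card ?E) + (card ?F + card ?F))"
    by (intro cUn) (auto simp: R_def power2_eq_square)
  also have "\<dots> \<le> (\<alpha> + \<beta> + 1)\<^sup>2 + 4 * (\<alpha> + \<beta> + 1) + 4 * (deviation \<alpha> \<beta> n + deviation \<beta> \<alpha> n)"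
    using card_exceptional[of \<alpha> \<beta> n] card_exceptional[of \<beta> \<alpha> n] by simp
  finally have RG: "card (R \<union> G) \<le> \<dots>" .
  have inG: "(x, y) \<in> G" if "upper \<alpha> \<beta> x y \<noteq> upper 0 0 x y \<or> upper \<beta> \<alpha> y x \<noteq> upper 0 0 y x"
    and "x \<le> n" "y \<le> n" for x y
  proof -
    have eq: "y = x + wy \<alpha> \<beta> x" if "upper \<alpha> \<beta> x y" for \<alpha> \<beta> x y
      using that by (simp add: upper_def)
    show ?thesis
      using that(1)
    proof
      assume "upper \<alpha> \<beta> x y \<noteq> upper 0 0 x y"
      then have "x \<in> ?E" "y = x + wy \<alpha> \<beta> x \<or> y = x + wy 0 0 x"
        using upper_unexceptional[of x n \<alpha> \<beta> y] \<open>x \<le> n\<close> eq by blast+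
      then show ?thesis unfolding G_def by blast
    next
      assume "upper \<beta> \<alpha> y x \<noteq> upper 0 0 y x"
      then have "y \<in> ?F" "x = y + wy \<beta> \<alpha> y \<or> x = y + wy 0 0 y"
        using upper_unexceptional[of y n \<beta> \<alpha> x] \<open>y \<le> n\<close> eq by blast+
      then show ?thesis unfolding G_def by blast
    qed
  qed
  have "sym_diff (shifted_P \<alpha> \<beta>) (shifted_P 0 0) \<inter> lattice_disc n \<subseteq> ?e ` (R \<union> G)"
  proof
    fix z assume z: "z \<in> sym_diff (shifted_P \<alpha> \<beta>) (shifted_P 0 0) \<inter> lattice_disc n"
    then obtain x y where xy: "z = (int x, int y)" by (auto simp: shifted_P_def)
    have iff: "(int x, int y) \<in> shifted_P \<alpha>' \<beta>' \<longleftrightarrow>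
      (\<beta>' \<le> x \<and> x \<le> \<alpha>' + \<beta>' \<and> \<alpha>' \<le> y \<and> y \<le> \<alpha>' + \<beta>') \<or> kernel \<alpha>' \<beta>' x y" for \<alpha>' \<beta>'
      by (simp add: shifted_P_def)
    have "(x, y) \<in> R \<union> G"
    proof (rule ccontr)
      assume no: "(x, y) \<notin> R \<union> G"
      have "x \<le> n" "y \<le> n" using z lattice_disc_bounds xy by auto
      then have "kernel \<alpha> \<beta> x y \<longleftrightarrow> kernel 0 0 x y"
        using no inG[of x y] by (auto simp: kernel_def)
      then show False using z no by (auto simp: xy iff R_def)
    qed
    then show "z \<in> ?e ` (R \<union> G)" by (auto simp: xy intro!: rev_image_eqI)
  qed
  then have "card (sym_diff (shifted_P \<alpha> \<beta>) (shifted_P 0 0) \<inter> lattice_disc n) \<le> card (?e ` (R \<union> G))"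
    by (rule card_mono[rotated]) (simp add: R_def G_def fin)
  also have "\<dots> \<le> card (R \<union> G)" by (intro card_image_le) (simp add: R_def G_def fin)
  finally show ?thesis using RG by simp
qed

text \<open>Every diagonal y - x = d with d > \<alpha> carries a point, in a column up to 2d +
  \<beta> by \<open>wy_lower_bound\<close>.\<close>

lemma infinite_shifted_P: "infinite (shifted_P \<alpha> \<beta>)"
proof
  assume fin: "finite (shifted_P \<alpha> \<beta>)"
  have "int ` {\<alpha><..} \<subseteq> (\<lambda>(x, y). y - x) ` shifted_P \<alpha> \<beta>"
  proof clarify
    fix d assume "\<alpha> < d"
    moreover have "d \<le> wy \<alpha> \<beta> (2 * d + \<beta>)" using wy_lower_bound[of "2 * d + \<beta>" \<alpha> \<beta>] by simp
    ultimately obtain s where "upper \<alpha> \<beta> s (s + d)" using upper_hits by blast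
    then have "(int s, int (s + d)) \<in> shifted_P \<alpha> \<beta>" unfolding shifted_P_def kernel_def by blast
    then show "int d \<in> (\<lambda>(x, y). y - x) ` shifted_P \<alpha> \<beta>" by (rule rev_image_eqI) simp
  qed
  then have "finite (int ` {\<alpha><..})" using fin finite_subset by blast
  then show False using infinite_Ioi[of \<alpha>] by (simp add: finite_image_iff)
qed

lemma card_unaltered_lower_bound: "n \<le> 6 * card (shifted_P 0 0 \<inter> lattice_disc n) + 2"
proof -
  define T where "T = n div 3"
  have "int ` {0<..wy 0 0 T} \<subseteq> (\<lambda>(x, y). y - x) ` (shifted_P 0 0 \<inter> lattice_disc n)"
  proof clarify
    fix d assume d: "d \<in> {0<..wy 0 0 T}"
    then obtain s where s: "s \<le> T" "upper 0 0 s (s + d)" using upper_hits[of 0 d 0 T] by auto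
    have "s + d \<le> 2 * T" using s d wy_le[of 0 0 T] by auto
    then have "s\<^sup>2 + (s + d)\<^sup>2 \<le> T\<^sup>2 + (2 * T)\<^sup>2" using s by (intro add_mono power_mono) auto
    also have "\<dots> \<le> (3 * T)\<^sup>2" by (simp add: power2_eq_square)
    also have "\<dots> \<le> n\<^sup>2" by (intro power_mono) (auto simp: T_def)
    finally have "int (s\<^sup>2 + (s + d)\<^sup>2) \<le> int (n\<^sup>2)" by (simp only: of_nat_le_iff)
    then have "(int s, int (s + d)) \<in> lattice_disc n" by (simp add: lattice_disc_def)
    moreover have "(int s, int (s + d)) \<in> shifted_P 0 0"
      using s(2) unfolding shifted_P_def kernel_def by blast
    ultimately have "(int s, int (s + d)) \<in> shifted_P 0 0 \<inter> lattice_disc n" by simp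
    then show "int d \<in> (\<lambda>(x, y). y - x) ` (shifted_P 0 0 \<inter> lattice_disc n)"
      by (rule rev_image_eqI) simp
  qed
  then have "card (int ` {0<..wy 0 0 T}) \<le> card (shifted_P 0 0 \<inter> lattice_disc n)"
    by (rule surj_card_le[rotated]) (simp add: finite_lattice_disc)
  then have "wy 0 0 T \<le> card (shifted_P 0 0 \<inter> lattice_disc n)" by (simp add: card_image)
  then show ?thesis using wy_lower_bound[of T 0 0] unfolding T_def by linarith
qed

section \<open>Passage to the limit\<close>

lemma asymptotically_equalI:
  fixes C :: real
  assumes inf: "infinite S" "infinite T"
    and small: "\<And>n. n \<ge> 1 \<Longrightarrow> real (card (sym_diff S T \<inter> lattice_disc n)) \<le> C * sqrt n"
    and large: "\<And>n. n \<le> 6 * card (T \<inter> lattice_disc n) + 2"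
  shows "asymptotically_equal S T"
proof -
  define i u e where "i n = real (card ((S \<inter> T) \<inter> lattice_disc n))"
    and "u n = real (card ((S \<union> T) \<inter> lattice_disc n))"
    and "e n = real (card (sym_diff S T \<inter> lattice_disc n))" for n
  note fin = finite_lattice_disc
  have sum: "u n = i n + e n" for n
  proof -
    have "(S \<union> T) \<inter> lattice_disc n = (S \<inter> T) \<inter> lattice_disc n \<union> sym_diff S T \<inter> lattice_disc n"
      by blast
    moreover have "((S \<inter> T) \<inter> lattice_disc n) \<inter> (sym_diff S T \<inter> lattice_disc n) = {}" by blast
    ultimately show ?thesis unfolding i_def u_def e_def
      using fin by (simp add: card_Un_disjoint)
  qed
  \<comment> \<open>From n = 4 on, 6 u(n) \<ge> n - 2 \<ge> n/2.\<close>
  have u: "real n / 12 \<le> u n" if "n \<ge> 4" for n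
  proof -
    have "card (T \<inter> lattice_disc n) \<le> card ((S \<union> T) \<inter> lattice_disc n)"
      by (rule card_mono) (auto simp: fin)
    then show ?thesis using large[of n] that by (simp add: u_def)
  qed
  have bound: "e n / u n \<le> 12 * C / sqrt n" if n: "n \<ge> 4" for n
  proof -
    have "e n / u n \<le> (C * sqrt n) / (real n / 12)"
      using small[of n] u[OF n] n by (intro frac_le) (auto simp: e_def)
    also have "\<dots> = 12 * C / sqrt n" using n by (simp add: field_simps)
    finally show ?thesis .
  qed
  have "(\<lambda>n. 12 * C / sqrt (real n)) \<longlonglongrightarrow> 0"
    by (intro tendsto_divide_0[OF tendsto_const] filterlim_at_top_imp_at_infinity
      filterlim_compose[OF sqrt_at_top] filterlim_real_sequentially)
  then have "(\<lambda>n. e n / u n) \<longlonglongrightarrow> 0"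
    by (rule tendsto_sandwich[rotated 2, OF tendsto_const])
      (auto simp: e_def u_def intro!: always_eventually eventually_sequentiallyI[of 4] bound[unfolded e_def u_def])
  then have "(\<lambda>n. 1 - e n / u n) \<longlonglongrightarrow> 1 - 0" by (intro tendsto_diff tendsto_const)
  moreover have "\<forall>\<^sub>F n in sequentially. 1 - e n / u n = i n / u n"
  proof (rule eventually_sequentiallyI[of 4])
    fix n :: nat assume "4 \<le> n"
    then have "u n > 0" using u[of n] by linarith
    then show "1 - e n / u n = i n / u n" using sum[of n] by (simp add: field_simps)
  qed
  ultimately have "(\<lambda>n. i n / u n) \<longlonglongrightarrow> 1"
    by (simp add: tendsto_cong)
  then show ?thesis using inf by (simp add: asymptotically_equal_def i_def u_def)
qed

lemma shifted_P_asymptotically_equal: "asymptotically_equal (shifted_P \<alpha> \<beta>) (shifted_P 0 0)"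
proof -
  \<comment> \<open>\<open>deviation_recursion\<close> exchanges \<alpha> and \<beta>, so only the
    symmetric sum is bounded by its own earlier values.\<close>
  define F where "F n = deviation \<alpha> \<beta> n + deviation \<beta> \<alpha> n" for n
  have "\<exists>C. \<forall>n\<ge>1. real (F n) \<le> C * sqrt n"
  proof (rule sqrt_growth)
    show "2 \<le> 8 + 4 * (\<alpha> + \<beta>)" by simp
    show "F n \<le> F (3 * n div 4) + F (\<alpha> + \<beta>)" if "8 + 4 * (\<alpha> + \<beta>) \<le> n" for n
      using deviation_recursion[of \<alpha> \<beta> n] deviation_recursion[of \<beta> \<alpha> n] that
      by (simp add: F_def add.commute)
  qed
  then obtain C where C: "\<And>n. n \<ge> 1 \<Longrightarrow> real (F n) \<le> C * sqrt n" by blast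
  define K where "K = (\<alpha> + \<beta> + 1)\<^sup>2 + 4 * (\<alpha> + \<beta> + 1)"
  show ?thesis
  proof (rule asymptotically_equalI[OF infinite_shifted_P infinite_shifted_P])
    show "n \<le> 6 * card (shifted_P 0 0 \<inter> lattice_disc n) + 2" for n
      by (rule card_unaltered_lower_bound)
    fix n :: nat assume n: "n \<ge> 1"
    have "real K * 1 \<le> real K * sqrt n" using n by (intro mult_left_mono) auto
    moreover have "card (sym_diff (shifted_P \<alpha> \<beta>) (shifted_P 0 0) \<inter> lattice_disc n) \<le> K + 4 * F n"
      using card_symmetric_difference[of \<alpha> \<beta> n] by (simp add: K_def F_def)
    then have "real (card (sym_diff (shifted_P \<alpha> \<beta>) (shifted_P 0 0) \<inter> lattice_disc n)) \<le> real K + 4 * real (F n)"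
      by linarith
    ultimately show "real (card (sym_diff (shifted_P \<alpha> \<beta>) (shifted_P 0 0) \<inter> lattice_disc n))
        \<le> (real K + 4 * C) * sqrt n"
      using C[OF n] by (simp add: algebra_simps)
  qed
qed

theorem theorem2:
  fixes a b :: nat
  assumes "a \<ge> 1" and "b \<ge> 1"
  shows "asymptotically_equal
           (translate (int b - 1, int a - 1) (P_positions ({0..<a} \<times> {0..<b}) {}))
           (P_positions {} {})"
proof -
  have "{0..<a} = {0..a - 1}" "{0..<b} = {0..b - 1}" "int b - 1 = int (b - 1)" "int a - 1 = int (a - 1)"
    using assms by auto
  then show ?thesis
    by (simp only: translate_P_positions P_positions_unaltered shifted_P_asymptotically_equal)
qed

end
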